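(* Let $1\le p\le\infty$, $f\in L^1(\mathbb{R}^d)$, $g\in L^p(\mathbb{R}^d)$ and let $\mu\colon\mathbb{R}^d\to\mathrm{GL}(d,\mathbb{R})$ be a measurable function. Then $f\ast_\mu^p g\in L^p(\mathbb{R}^d)$ and $$\|f\ast_\mu^p g\|_p\le\|f\|_1\,\|g\|_p .$$
   Context: For $f\in L^1(\mathbb{R}^d)$, $g\in L^p(\mathbb{R}^d)$, $1\le p\le\infty$, and measurable $\mu\colon\mathbb{R}^d\to\mathrm{GL}(d,\mathbb{R})$, the $\mu$-adaptive convolution of $f$ with $g$ is $$(f\ast_\mu^p g)(x):=\int_{\mathbb{R}^d} f(y)\,|\det\mu(y)|^{1/p}\,g\big(\mu(y)(x-y)\big)\,dy,$$ where $1/p:=0$ for $p=\infty$. All $L^p$ norms are with respect to Lebesgue measure on $\mathbb{R}^d$. *)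

theory Defs
  imports "HOL-Analysis.Analysis" "HOL-Probability.Essential_Supremum"
begin

(* The exponent p ranges over the extended nonnegative reals, so that p = \<infinity> is allowed.
   Elements of L^p are rendered by their representatives, i.e. honest functions; nothing is
   identified modulo equality almost everywhere. *)

definition Lp_space :: "ennreal \<Rightarrow> 'a measure \<Rightarrow> ('a \<Rightarrow> 'b::real_normed_vector) set" where
  "Lp_space p M = {f \<in> borel_measurable M.
     if p = \<infinity> then esssup M (\<lambda>x. ennreal (norm (f x))) < \<infinity>
     else integrable M (\<lambda>x. norm (f x) powr enn2real p)}"

(* Only meaningful on Lp_space p M: elsewhere the integral and enn2real return default values. *)
definition Lp_norm :: "ennreal \<Rightarrow> 'a measure \<Rightarrow> ('a \<Rightarrow> 'b::real_normed_vector) \<Rightarrow> real" where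
  "Lp_norm p M f =
     (if p = \<infinity> then enn2real (esssup M (\<lambda>x. ennreal (norm (f x))))
      else (LINT x|M. norm (f x) powr enn2real p) powr (1 / enn2real p))"

definition recip_exponent :: "ennreal \<Rightarrow> real" where
  "recip_exponent p = (if p = \<infinity> then 0 else 1 / enn2real p)"

(* The scalars 'b are a real Banach division algebra with multiplicative norm and commutative
   multiplication; both real and complex are instances. *)
definition adaptive_integrand ::
  "ennreal \<Rightarrow> (real^'n \<Rightarrow> real^'n^'n) \<Rightarrow> (real^'n \<Rightarrow> 'b) \<Rightarrow> (real^'n \<Rightarrow> 'b) \<Rightarrow>
     real^'n \<Rightarrow> real^'n \<Rightarrow> 'b::{real_normed_field, banach, second_countable_topology}" where
  "adaptive_integrand p \<mu> f g x y =
     f y * of_real (\<bar>det (\<mu> y)\<bar> powr recip_exponent p) * g (\<mu> y *v (x - y))"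

definition adaptive_convolution ::
  "ennreal \<Rightarrow> (real^'n \<Rightarrow> real^'n^'n) \<Rightarrow> (real^'n \<Rightarrow> 'b) \<Rightarrow> (real^'n \<Rightarrow> 'b) \<Rightarrow>
     real^'n \<Rightarrow> 'b::{real_normed_field, banach, second_countable_topology}" where
  "adaptive_convolution p \<mu> f g x = (LINT y|lebesgue. adaptive_integrand p \<mu> f g x y)"

(* sanity checks: both scalar fields are covered, and p = 1 is the usual notion *)
lemma "OFCLASS(real, real_normed_field_class)" "OFCLASS(real, banach_class)"
  "OFCLASS(real, second_countable_topology_class)"
  "OFCLASS(complex, real_normed_field_class)" "OFCLASS(complex, banach_class)"
  "OFCLASS(complex, second_countable_topology_class)"
  by intro_classes

lemma "f \<in> Lp_space 1 M \<longleftrightarrow> integrable M (f :: 'a \<Rightarrow> 'b::{banach,second_countable_topology})"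
  by (auto simp: Lp_space_def integrable_norm_iff)
lemma "Lp_norm 1 M f = (LINT x|M. norm (f x))"
  by (simp add: Lp_norm_def)

end

theory Submission
  imports Defs
begin

text \<open>
  For each fixed \<open>y\<close>, the map \<open>x \<mapsto> \<mu> y (x - y)\<close> scales Lebesgue measure by
  \<open>\<bar>det (\<mu> y)\<bar>\<close>, so the factor \<open>\<bar>det (\<mu> y)\<bar>\<^sup>1\<^sup>/\<^sup>p\<close> makes
  \<open>x \<mapsto> \<bar>det (\<mu> y)\<bar>\<^sup>1\<^sup>/\<^sup>p g (\<mu> y (x - y))\<close> have the same \<open>L\<^sup>p\<close> norm as \<open>g\<close>. The adaptive
  convolution is thus an average of functions of norm \<open>\<parallel>g\<parallel>\<^sub>p\<close> with weights \<open>f y\<close>, and the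
  bound is Minkowski's inequality for integrals.

  For finite \<open>p\<close>, convexity of \<open>t \<mapsto> t\<^sup>p\<close> (\<open>weighted_powr_mean\<close>) bounds the \<open>p\<close>-th power of the
  convolution at \<open>x\<close> by \<open>\<parallel>f\<parallel>\<^sub>1\<close> to the power \<open>p - 1\<close>, times the integral over \<open>y\<close> of
  \<open>\<bar>f y\<bar> \<bar>det (\<mu> y)\<bar> \<bar>g (\<mu> y (x - y))\<bar>\<^sup>p\<close>. Tonelli's theorem and the change of variables
  (\<open>nn_integral_adaptive\<close>) evaluate the \<open>x\<close>-integral of the latter as \<open>\<parallel>f\<parallel>\<^sub>1 \<parallel>g\<parallel>\<^sub>p\<^sup>p\<close>; in
  particular the inner integral is finite for almost every \<open>x\<close>, so the convolution exists there.
  For \<open>p = \<infinity>\<close>, the set where \<open>\<bar>g\<bar>\<close> exceeds its essential supremum is null, and for almost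
  every \<open>x\<close> its preimage under \<open>y \<mapsto> \<mu> y (x - y)\<close> is null too (\<open>AE_adaptive\<close>).

  Tonelli's theorem needs joint measurability, but \<open>g (\<mu> y (x - y))\<close> need not be measurable in
  \<open>y\<close> when \<open>g\<close> is only Lebesgue measurable. Hence \<open>f\<close>, \<open>g\<close>, \<open>\<mu>\<close> are first replaced by Borel
  functions that agree with them off a null set (\<open>completion_ex_borel_modification\<close>). By
  \<open>AE_adaptive\<close> again, for almost every \<open>x\<close> this alters the integrand only on a null set of
  \<open>y\<close>, hence alters the convolution only on a null set of \<open>x\<close>.
\<close>

section \<open>Change of variables for invertible matrices\<close>

text \<open>
  By Tonelli, integrate along the line in direction \<open>e\<close> first: there the map is a translation,
  because \<open>c\<close> is constant on the line.
\<close>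
lemma nn_integral_lborel_shear:
  fixes h :: "'a::euclidean_space \<Rightarrow> ennreal" and c :: "'a \<Rightarrow> real"
  assumes e: "e \<in> Basis"
    and [measurable]: "h \<in> borel_measurable borel" "c \<in> borel_measurable borel"
    and c: "\<And>x t. c (x + t *\<^sub>R e) = c x"
  shows "(\<integral>\<^sup>+x. h (x + c x *\<^sub>R e) \<partial>lborel) = (\<integral>\<^sup>+x. h x \<partial>lborel)"
proof -
  interpret L: product_sigma_finite "\<lambda>_::'a. lborel :: real measure" ..
  let ?B = "Basis - {e}"
  define z where "z y = (\<Sum>b\<in>?B. y b *\<^sub>R b)" for y :: "'a \<Rightarrow> real"
  have ins: "insert e ?B = Basis" using e by auto
  have split: "(\<integral>\<^sup>+x. k x \<partial>lborel) = (\<integral>\<^sup>+y. (\<integral>\<^sup>+t. k (z y + t *\<^sub>R e) \<partial>lborel) \<partial>(\<Pi>\<^sub>M b\<in>?B. lborel))"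
    if [measurable]: "k \<in> borel_measurable borel" for k :: "'a \<Rightarrow> ennreal"
  proof -
    have "(\<integral>\<^sup>+x. k x \<partial>lborel) = (\<integral>\<^sup>+f. k (\<Sum>b\<in>Basis. f b *\<^sub>R b) \<partial>(\<Pi>\<^sub>M b\<in>(Basis::'a set). lborel))"
      by (subst lborel_eq) (simp add: nn_integral_distr)
    also have "\<dots> = (\<integral>\<^sup>+f. k (\<Sum>b\<in>Basis. f b *\<^sub>R b) \<partial>(\<Pi>\<^sub>M b\<in>insert e ?B. lborel))"
      unfolding ins ..
    also have "\<dots> = (\<integral>\<^sup>+y. (\<integral>\<^sup>+t. k (\<Sum>b\<in>Basis. (y(e := t)) b *\<^sub>R b) \<partial>lborel) \<partial>(\<Pi>\<^sub>M b\<in>?B. lborel))"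
      by (rule L.product_nn_integral_insert) (simp_all add: ins)
    also have "(\<lambda>y t. (\<Sum>b\<in>Basis. (y(e := t)) b *\<^sub>R b)) = (\<lambda>y t. z y + t *\<^sub>R e)"
      by (intro ext) (simp add: z_def sum.remove[OF _ e] add.commute)
    finally show ?thesis .
  qed
  have "(\<integral>\<^sup>+x. h (x + c x *\<^sub>R e) \<partial>lborel) =
      (\<integral>\<^sup>+y. (\<integral>\<^sup>+t. h (z y + (c (z y) + 1 * t) *\<^sub>R e) \<partial>lborel) \<partial>(\<Pi>\<^sub>M b\<in>?B. lborel))"
    by (subst split) (simp_all add: c scaleR_add_left ac_simps)
  also have "\<dots> = (\<integral>\<^sup>+y. (\<integral>\<^sup>+t. h (z y + t *\<^sub>R e) \<partial>lborel) \<partial>(\<Pi>\<^sub>M b\<in>?B. lborel))"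
    using nn_integral_real_affine[where f = "\<lambda>t. h (z y + t *\<^sub>R e)" and c = 1 and t = "c (z y)" for y]
    by simp
  finally show ?thesis
    by (simp add: split)
qed

text \<open>Swapping coordinates maps a box to a box with permuted side lengths.\<close>
lemma distr_lborel_transpose:
  "distr lborel borel (\<lambda>x::real^'n. \<chi> i. x $ Transposition.transpose m n i) = lborel"
  (is "distr _ _ ?T = _")
proof (rule lborel_eqI[symmetric])
  let ?\<tau> = "Transposition.transpose m n"
  have [measurable]: "?T \<in> borel_measurable borel"
    by (intro borel_measurable_continuous_onI continuous_intros)
  fix l u :: "real^'n" assume le: "\<And>b. b \<in> Basis \<Longrightarrow> l \<bullet> b \<le> u \<bullet> b"
  then have le': "l $ i \<le> u $ i" for i
    by (simp add: cart_eq_inner_axis)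
  have "?T -` box l u = box (?T l) (?T u)"
    by (auto simp: mem_box_cart) (metis transpose_involutory)+
  moreover have "\<And>b. b \<in> Basis \<Longrightarrow> ?T l \<bullet> b \<le> ?T u \<bullet> b"
    using le' by (auto simp: Basis_vec_def inner_axis)
  moreover have "(\<Prod>b\<in>Basis. w \<bullet> b) = (\<Prod>i\<in>UNIV. w $ i)" for w :: "real^'n"
    by (subst Basis_vec_def)
      (simp add: UNION_singleton_eq_range prod.reindex inj_on_def axis_eq_axis inner_axis)
  moreover have "(\<Prod>i\<in>UNIV. (?T u - ?T l) $ i) = (\<Prod>i\<in>UNIV. (u - l) $ i)"
    by (simp, rule prod.reindex_bij_betw[OF bij_transpose, where g = "\<lambda>i. u $ i - l $ i"])
  ultimately show "emeasure (distr lborel borel ?T) (box l u) = (\<Prod>b\<in>Basis. (u - l) \<bullet> b)"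
    by (simp add: emeasure_distr)
qed simp

lemma borel_measurable_matrix_vector_mult [measurable (raw)]:
  assumes [measurable]: "A \<in> borel_measurable M" "v \<in> borel_measurable M"
  shows "(\<lambda>x. (A x :: real^'n^'m) *v v x) \<in> borel_measurable M"
  using assms by (rule borel_measurable_continuous_Pair)
    (auto simp: matrix_vector_mult_def intro!: continuous_intros)

lemma borel_measurable_det [measurable (raw)]:
  assumes "A \<in> borel_measurable M"
  shows "(\<lambda>x. det (A x :: real^'n^'n)) \<in> borel_measurable M"
proof -
  have "continuous_on UNIV (det :: real^'n^'n \<Rightarrow> real)"
    unfolding det_def by (intro continuous_intros)
  from borel_measurable_continuous_onI[OF this] assms show ?thesis
    by (rule measurable_compose_rev)
qed

text \<open>
  The statement is multiplicative in \<open>A\<close>, so it is enough to treat diagonal matrices, swaps of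
  two coordinates and shears, which generate the invertible ones.
\<close>
lemma nn_integral_lborel_matrix:
  fixes A :: "real^'n^'n" and h :: "real^'n \<Rightarrow> ennreal"
  assumes "h \<in> borel_measurable borel" "det A \<noteq> 0"
  shows "ennreal \<bar>det A\<bar> * (\<integral>\<^sup>+x. h (A *v x) \<partial>lborel) = (\<integral>\<^sup>+x. h x \<partial>lborel)"
  using assms
proof (induction A arbitrary: h rule: induct_matrix_elementary_alt)
  case (1 A B)
  note [measurable] = 1(3)
  have "ennreal \<bar>det (A ** B)\<bar> * (\<integral>\<^sup>+x. h ((A ** B) *v x) \<partial>lborel)
      = ennreal \<bar>det A\<bar> * (ennreal \<bar>det B\<bar> * (\<integral>\<^sup>+x. h (A *v (B *v x)) \<partial>lborel))"
    by (simp add: det_mul abs_mult ennreal_mult matrix_vector_mul_assoc mult.assoc)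
  also have "\<dots> = (\<integral>\<^sup>+x. h x \<partial>lborel)"
    using 1(1)[of h] 1(2)[of "\<lambda>x. h (A *v x)"] 1(4) by (simp add: det_mul)
  finally show ?case .
next
  case (2 A i)
  then show ?case by (metis det_zero_row(2))
next
  case (3 A)
  note [measurable] = 3(2)
  define c where "c b = A $ axis_index b $ axis_index b" for b :: "real^'n"
  have d: "det A = (\<Prod>i\<in>UNIV. A $ i $ i)"
    using 3 by (simp add: det_diagonal)
  have B: "(Basis :: (real^'n) set) = range (\<lambda>i. axis i 1)"
    by (auto simp: Basis_vec_def)
  have ax: "axis_index (axis i 1 :: real^'n) = i" for i
    using axis_index[of "axis i 1 :: real^'n"] by (simp add: axis_eq_axis)
  have prod: "(\<Prod>b\<in>Basis. \<bar>c b\<bar>) = \<bar>det A\<bar>"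
    unfolding B d c_def by (subst prod.reindex) (auto simp: inj_on_def axis_eq_axis ax abs_prod)
  have c0: "c j \<noteq> 0" for j
    using \<open>det A \<noteq> 0\<close> unfolding d c_def by simp
  have "A *v x = 0 + (\<Sum>j\<in>Basis. (c j * (x \<bullet> j)) *\<^sub>R j)" for x
  proof -
    have "(\<Sum>j\<in>Basis. (c j * (x \<bullet> j)) *\<^sub>R j) = (\<Sum>i\<in>UNIV. (A $ i $ i * x $ i) *\<^sub>R axis i 1)"
      unfolding B c_def by (subst sum.reindex) (auto simp: inj_on_def axis_eq_axis ax inner_axis)
    moreover have "(A *v x) $ i = A $ i $ i * x $ i" for i
      unfolding matrix_vector_mult_def using 3(1)
      by simp (subst sum.remove[of _ i], auto intro!: sum.neutral)
    ultimately show ?thesis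
      by (simp add: vec_eq_iff axis_def if_distrib cong: if_cong)
  qed
  then have "lborel = density (distr lborel borel (\<lambda>x. A *v x)) (\<lambda>_. (\<Prod>j\<in>Basis. \<bar>c j\<bar>))"
    using lborel_affine_euclidean[of c 0] c0 by presburger
  then have "(\<integral>\<^sup>+x. h x \<partial>lborel) = (\<integral>\<^sup>+x. h x \<partial>density (distr lborel borel (\<lambda>x. A *v x)) (\<lambda>_. \<bar>det A\<bar>))"
    unfolding prod by simp
  also have "\<dots> = ennreal \<bar>det A\<bar> * (\<integral>\<^sup>+x. h (A *v x) \<partial>lborel)"
    by (simp add: nn_integral_density nn_integral_distr nn_integral_cmult)
  finally show ?case ..
next
  case (4 m n)
  note [measurable] = 4(2)
  let ?A = "\<chi> i j. mat 1 $ i $ Transposition.transpose m n j :: real^'n^'n"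
  have A: "?A *v x = (\<chi> i. x $ Transposition.transpose m n i)" for x
  proof -
    have "mat 1 $ i $ Transposition.transpose m n j * x $ j =
        (if j = Transposition.transpose m n i then x $ j else 0)" for i j
      by (auto simp: mat_def)
    then show ?thesis
      by (simp add: vec_eq_iff matrix_vector_mult_def)
  qed
  \<comment> \<open>A swap is an involution, so its determinant squares to 1.\<close>
  have "?A ** ?A = mat 1"
    by (simp add: matrix_eq matrix_vector_mul_assoc[symmetric] A)
  then have "det ?A * det ?A = 1"
    by (metis det_I det_mul)
  then have "\<bar>det ?A\<bar> = 1"
    unfolding square_eq_1_iff by linarith
  moreover have "(\<integral>\<^sup>+x. h (?A *v x) \<partial>lborel) = (\<integral>\<^sup>+x. h x \<partial>lborel)"
  proof -
    have T: "(\<lambda>x::real^'n. \<chi> i. x $ Transposition.transpose m n i) \<in> borel_measurable borel"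
      by (intro borel_measurable_continuous_onI continuous_intros)
    show ?thesis
      using nn_integral_distr[of "\<lambda>x::real^'n. \<chi> i. x $ Transposition.transpose m n i" lborel borel h] T
      unfolding A by (simp only: distr_lborel_transpose measurable_lborel2 simp_thms) simp
  qed
  ultimately show ?case by simp
next
  case (5 m n)
  let ?A = "\<chi> i j. of_bool (i = m \<and> j = n \<or> i = j) :: real^'n^'n"
  have A: "?A *v x = x + (x $ n) *\<^sub>R axis m 1" for x
  proof -
    have "of_bool (i = m \<and> j = n \<or> i = j) * x $ j
        = of_bool (i = m) * (of_bool (j = n) * x $ n) + of_bool (j = i) * x $ i" for i j
      using \<open>m \<noteq> n\<close> by auto
    then show ?thesis
      by (simp add: vec_eq_iff matrix_vector_mult_def sum.distrib axis_def of_bool_def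
          sum_distrib_left[symmetric] if_distrib[where f = "\<lambda>z. z * _"] cong: if_cong)
  qed
  have "?A = (\<chi> k. if k = m then row m (mat 1) + 1 *s row n (mat 1) else row k (mat 1))"
    using \<open>m \<noteq> n\<close> by (auto simp: vec_eq_iff row_def mat_def)
  then have "det ?A = 1"
    using det_row_operation[OF \<open>m \<noteq> n\<close>, of "mat 1 :: real^'n^'n" 1] by simp
  moreover have "(\<integral>\<^sup>+x. h (?A *v x) \<partial>lborel) = (\<integral>\<^sup>+x. h x \<partial>lborel)"
    unfolding A using 5 by (intro nn_integral_lborel_shear) (simp_all add: axis_in_Basis_iff, simp add: axis_def)
  ultimately show ?case by simp
qed

lemma nn_integral_lborel_affine:
  fixes A :: "real^'n^'n" and h :: "real^'n \<Rightarrow> ennreal"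
  assumes [measurable]: "h \<in> borel_measurable borel" and "det A \<noteq> 0"
  shows "ennreal \<bar>det A\<bar> * (\<integral>\<^sup>+x. h (A *v (x - y)) \<partial>lborel) = (\<integral>\<^sup>+x. h x \<partial>lborel)"
proof -
  have "(\<integral>\<^sup>+x. h (A *v x) \<partial>lborel) = (\<integral>\<^sup>+x. h (A *v (x - y)) \<partial>lborel)"
    by (subst lborel_distr_plus[symmetric, of "- y"]) (simp add: nn_integral_distr)
  with nn_integral_lborel_matrix[OF assms] show ?thesis
    by simp
qed

section \<open>Modification on null sets\<close>

text \<open>
  Each preimage of a basic open set differs from a measurable set only inside a null set.
  Since a countable basis generates the Borel sets, the union of these null sets is one null
  set off which the function is measurable. The value \<open>c\<close> on that set can be chosen freely, so
  that invertibility of a matrix-valued function survives the modification.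
\<close>
lemma completion_ex_borel_modification:
  fixes f :: "'a \<Rightarrow> 'b::second_countable_topology"
  assumes f: "f \<in> borel_measurable (completion M)"
  obtains N where "N \<in> null_sets M" "(\<lambda>x. if x \<in> N then c else f x) \<in> borel_measurable M"
proof -
  obtain B :: "'b set set" where B: "countable B" "topological_basis B"
    using ex_countable_basis by blast
  have "\<exists>S N. S \<in> sets M \<and> N \<in> null_sets M \<and> S - N = f -` b \<inter> space M - N" if "b \<in> B" for b
  proof -
    have "b \<in> sets borel"
      using B(2) that by (simp add: topological_basis_open)
    with f have "f -` b \<inter> space M \<in> sets (completion M)"
      using measurable_sets[OF f] by simp
    then obtain S N N' where "f -` b \<inter> space M = S \<union> N" "N \<subseteq> N'" "N' \<in> null_sets M" "S \<in> sets M"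
      by (rule sets_completionE)
    then have "S \<in> sets M \<and> N' \<in> null_sets M \<and> S - N' = f -` b \<inter> space M - N'"
      by auto
    then show ?thesis by blast
  qed
  then obtain S N where S: "\<And>b. b \<in> B \<Longrightarrow> S b \<in> sets M"
    and N: "\<And>b. b \<in> B \<Longrightarrow> N b \<in> null_sets M"
    and eq: "\<And>b. b \<in> B \<Longrightarrow> S b - N b = f -` b \<inter> space M - N b"
    by metis
  define Z where "Z = (\<Union>b\<in>B. N b)"
  have null: "Z \<in> null_sets M"
    unfolding Z_def using B(1) N by (rule null_sets_UN')
  then have Z: "Z \<in> sets M" by auto
  have "(\<lambda>x. if x \<in> Z then c else f x) \<in> measurable M (sigma UNIV B)"
  proof (rule measurable_measure_of)
    fix b assume b: "b \<in> B"
    have "x \<in> S b \<longleftrightarrow> x \<in> space M \<and> f x \<in> b" if "x \<notin> Z" for x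
    proof -
      have "x \<notin> N b" using that b by (auto simp: Z_def)
      then show ?thesis using eq[OF b] by blast
    qed
    then have "(\<lambda>x. if x \<in> Z then c else f x) -` b \<inter> space M = (if c \<in> b then S b \<union> Z else S b - Z)"
      using sets.sets_into_space[OF Z] by (auto split: if_splits)
    then show "(\<lambda>x. if x \<in> Z then c else f x) -` b \<inter> space M \<in> sets M"
      using S[OF b] Z by simp
  qed auto
  then have "(\<lambda>x. if x \<in> Z then c else f x) \<in> borel_measurable M"
    by (simp add: borel_eq_countable_basis[OF B])
  with null show ?thesis by (rule that)
qed

lemma completion_AE_eq_measurable:
  assumes g: "g \<in> borel_measurable M" and eq: "AE x in M. f x = g x"
  shows "f \<in> borel_measurable (completion M)"
proof (rule measurableI)
  fix S :: "'b::topological_space set" assume S: "S \<in> sets borel"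
  show "f -` S \<inter> space (completion M) \<in> sets (completion M)"
  proof (rule completion.in_sets_AE)
    show "g -` S \<inter> space M \<in> sets (completion M)"
      using measurable_sets[OF g S] by simp
    show "AE x in completion M. x \<in> g -` S \<inter> space M \<longleftrightarrow> x \<in> f -` S \<inter> space (completion M)"
      using AE_completion[OF eq] by eventually_elim simp
  qed auto
qed simp

lemma Lp_AE_cong:
  fixes f g :: "'a \<Rightarrow> 'b::{real_normed_vector, second_countable_topology}"
  assumes f[measurable]: "f \<in> borel_measurable M" and g[measurable]: "g \<in> borel_measurable M"
    and eq: "AE x in M. f x = g x"
  shows "f \<in> Lp_space p M \<longleftrightarrow> g \<in> Lp_space p M" and "Lp_norm p M f = Lp_norm p M g"
proof -
  have "esssup M (\<lambda>x. ennreal (norm (f x))) = esssup M (\<lambda>x. ennreal (norm (g x)))"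
    using eq by (intro esssup_AE_cong) (auto elim!: eventually_mono)
  moreover have "integrable M (\<lambda>x. norm (f x) powr enn2real p)
      \<longleftrightarrow> integrable M (\<lambda>x. norm (g x) powr enn2real p)"
    using eq by (intro integrable_cong_AE) (auto elim!: eventually_mono)
  moreover have "(LINT x|M. norm (f x) powr enn2real p) = (LINT x|M. norm (g x) powr enn2real p)"
    using eq by (intro integral_cong_AE) (auto elim!: eventually_mono)
  ultimately show "f \<in> Lp_space p M \<longleftrightarrow> g \<in> Lp_space p M" and "Lp_norm p M f = Lp_norm p M g"
    by (simp_all add: Lp_space_def Lp_norm_def)
qed

section \<open>A power mean inequality\<close>

text \<open>The convex function \<open>h powr p\<close> lies above its tangent at \<open>t\<close>; this is Young's inequality.\<close>
lemma powr_ge_tangent: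
  fixes h t p :: real
  assumes "1 \<le> p" "0 \<le> h" "0 < t"
  shows "t powr p + p * t powr (p - 1) * (h - t) \<le> h powr p"
proof (cases "h = 0")
  case True
  have "t powr p = t powr (p - 1) * t"
    using \<open>0 < t\<close> by (simp add: powr_diff)
  then show ?thesis
    using True assms mult_right_mono[of 1 p "t powr p"] by (simp add: algebra_simps)
next
  case False
  have "(h powr p) powr (1/p) * (t powr p) powr (1 - 1/p) \<le> 1/p * h powr p + (1 - 1/p) * t powr p"
    using assms False by (intro Youngs_inequality_0) auto
  moreover have "(h powr p) powr (1/p) = h" "(t powr p) powr (1 - 1/p) = t powr (p - 1)"
    using assms False by (auto simp: powr_powr right_diff_distrib)
  ultimately have "h * t powr (p - 1) \<le> 1/p * h powr p + (1 - 1/p) * t powr p"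
    by simp
  then have "p * (h * t powr (p - 1)) \<le> p * (1/p * h powr p + (1 - 1/p) * t powr p)"
    using assms by (intro mult_left_mono) auto
  also have "\<dots> = h powr p + (p - 1) * t powr p"
    using assms by (simp add: field_simps)
  finally have "p * t powr (p - 1) * h \<le> h powr p + (p - 1) * t powr p"
    by (simp add: ac_simps)
  moreover have "t powr p = t powr (p - 1) * t"
    using \<open>0 < t\<close> by (simp add: powr_diff)
  ultimately show ?thesis by (simp add: algebra_simps)
qed

text \<open>
  Jensen's inequality for the measure with density \<open>w\<close>, without normalising it: integrate the
  tangent inequality \<open>powr_ge_tangent\<close> at \<open>t\<close> equal to the \<open>w\<close>-mean of \<open>h\<close>, where the linear
  term integrates to zero.
\<close>
lemma weighted_powr_mean:
  fixes w h :: "'a \<Rightarrow> real"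
  assumes p: "1 \<le> p" and w: "integrable M w" "\<And>x. 0 \<le> w x"
    and h: "h \<in> borel_measurable M" "\<And>x. 0 \<le> h x"
    and wh: "integrable M (\<lambda>x. w x * h x powr p)"
  shows "integrable M (\<lambda>x. w x * h x)"
    and "(LINT x|M. w x * h x) powr p \<le> (LINT x|M. w x) powr (p - 1) * (LINT x|M. w x * h x powr p)"
proof -
  note [measurable] = h(1) borel_measurable_integrable[OF w(1)]
  have le: "s \<le> 1 + s powr p" if "0 \<le> s" for s :: real
  proof (cases "s \<le> 1")
    case False
    then show ?thesis using p powr_mono[of 1 p s] by simp
  qed (use add_mono[of s 1 0 "s powr p"] in simp)
  show int: "integrable M (\<lambda>x. w x * h x)"
  proof (rule Bochner_Integration.integrable_bound)
    show "integrable M (\<lambda>x. w x + w x * h x powr p)"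
      using w(1) wh by simp
    show "AE x in M. norm (w x * h x) \<le> norm (w x + w x * h x powr p)"
      using mult_left_mono[OF le[OF h(2)] w(2)] w(2) h(2) by (simp add: abs_mult distrib_left)
  qed simp
  let ?F = "LINT x|M. w x" and ?I = "LINT x|M. w x * h x" and ?A = "LINT x|M. w x * h x powr p"
  have pos: "0 \<le> ?F" "0 \<le> ?I" "0 \<le> ?A"
    using w(2) h(2) by (auto intro!: integral_nonneg_AE)
  show "?I powr p \<le> ?F powr (p - 1) * ?A"
  proof (cases "?I = 0")
    case True
    with pos show ?thesis by simp
  next
    case False
    have "?F \<noteq> 0"
    proof
      assume "?F = 0"
      then have "AE x in M. w x = 0"
        using integral_nonneg_eq_0_iff_AE[OF w(1)] w(2) by simp
      then have "?I = 0" by (intro integral_eq_zero_AE) auto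
      with False show False by simp
    qed
    with False pos have F: "0 < ?F" and I: "0 < ?I" by simp_all
    define t where "t = ?I / ?F"
    have t: "0 < t" using F I by (simp add: t_def)
    have "t powr p * ?F = (LINT x|M. t powr p * w x + p * t powr (p - 1) * (w x * h x - t * w x))"
      using w(1) int F by (simp add: t_def)
    also have "\<dots> \<le> ?A"
    proof (rule integral_mono)
      fix x
      show "t powr p * w x + p * t powr (p - 1) * (w x * h x - t * w x) \<le> w x * h x powr p"
        using mult_left_mono[OF powr_ge_tangent[OF p h(2) t] w(2)[of x]]
        by (simp add: algebra_simps)
    qed (use w int wh in auto)
    finally have "?F powr (p - 1) * (t powr p * ?F) \<le> ?F powr (p - 1) * ?A"
      by (intro mult_left_mono) auto
    moreover have "?F powr (p - 1) * (t powr p * ?F) = ?I powr p"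
      using F I by (simp add: t_def powr_divide powr_diff)
    ultimately show ?thesis by simp
  qed
qed

section \<open>Adaptive convolution of Borel functions\<close>

text \<open>
  After exchanging the integrals, the change of variables turns the inner integral into that of
  \<open>h\<close>, whatever \<open>y\<close> is.
\<close>
lemma nn_integral_adaptive:
  fixes w h :: "real^'n \<Rightarrow> ennreal" and \<mu> :: "real^'n \<Rightarrow> real^'n^'n"
  assumes [measurable]: "w \<in> borel_measurable borel" "h \<in> borel_measurable borel"
      "\<mu> \<in> borel_measurable borel"
    and det: "\<And>y. det (\<mu> y) \<noteq> 0"
  shows "(\<integral>\<^sup>+x. \<integral>\<^sup>+y. w y * (ennreal \<bar>det (\<mu> y)\<bar> * h (\<mu> y *v (x - y))) \<partial>lborel \<partial>lborel)
    = (\<integral>\<^sup>+y. w y \<partial>lborel) * (\<integral>\<^sup>+x. h x \<partial>lborel)"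
proof -
  have "(\<integral>\<^sup>+x. \<integral>\<^sup>+y. w y * (ennreal \<bar>det (\<mu> y)\<bar> * h (\<mu> y *v (x - y))) \<partial>lborel \<partial>lborel)
      = (\<integral>\<^sup>+y. \<integral>\<^sup>+x. w y * (ennreal \<bar>det (\<mu> y)\<bar> * h (\<mu> y *v (x - y))) \<partial>lborel \<partial>lborel)"
    by (rule lborel_pair.Fubini'[symmetric]) measurable
  also have "\<dots> = (\<integral>\<^sup>+y. w y * (\<integral>\<^sup>+x. h x \<partial>lborel) \<partial>lborel)"
    using det by (simp add: nn_integral_cmult nn_integral_lborel_affine)
  finally show ?thesis
    by (simp add: nn_integral_multc)
qed

text \<open>
  Apply \<open>nn_integral_adaptive\<close> to the indicator of a Borel null set containing the exceptional
  points. The weight 1 has infinite integral, but \<open>\<infinity> * 0 = 0\<close>.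
\<close>
lemma AE_adaptive:
  fixes \<mu> :: "real^'n \<Rightarrow> real^'n^'n"
  assumes [measurable]: "\<mu> \<in> borel_measurable borel" and det: "\<And>y. det (\<mu> y) \<noteq> 0"
    and P: "AE z in lborel. P z"
  shows "AE x in lborel. AE y in lborel. P (\<mu> y *v (x - y))"
proof -
  obtain N where N: "{z. \<not> P z} \<subseteq> N" "N \<in> sets borel" "emeasure lborel N = 0"
    using P by (auto elim!: AE_E)
  note [measurable] = N(2)
  have "(\<integral>\<^sup>+x. \<integral>\<^sup>+y. 1 * (ennreal \<bar>det (\<mu> y)\<bar> * indicator N (\<mu> y *v (x - y))) \<partial>lborel \<partial>lborel) = 0"
    using N by (subst nn_integral_adaptive) (simp_all add: det)
  then have "AE x in lborel.
      (\<integral>\<^sup>+y. 1 * (ennreal \<bar>det (\<mu> y)\<bar> * indicator N (\<mu> y *v (x - y))) \<partial>lborel) = 0"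
    by (subst (asm) nn_integral_0_iff_AE) measurable
  then show ?thesis
  proof eventually_elim
    case (elim x)
    then have "AE y in lborel. 1 * (ennreal \<bar>det (\<mu> y)\<bar> * indicator N (\<mu> y *v (x - y))) = 0"
      by (subst (asm) nn_integral_0_iff_AE) measurable
    then show ?case
      using N(1) det by (auto elim!: eventually_mono simp: indicator_def split: if_splits)
  qed
qed

lemma borel_measurable_adaptive_integrand [measurable]:
  fixes f g :: "real^'n \<Rightarrow> 'b::{real_normed_field, banach, second_countable_topology}"
  assumes [measurable]: "f \<in> borel_measurable borel" "g \<in> borel_measurable borel"
      "\<mu> \<in> borel_measurable borel"
  shows "(\<lambda>(x, y). adaptive_integrand p \<mu> f g x y) \<in> borel_measurable (lborel \<Otimes>\<^sub>M lborel)"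
  unfolding adaptive_integrand_def by measurable

lemma adaptive_convolution_borel_finite:
  fixes f g :: "real^'n \<Rightarrow> 'b::{real_normed_field, banach, second_countable_topology}"
  assumes p: "1 \<le> p" "p \<noteq> \<infinity>"
    and meas [measurable]: "f \<in> borel_measurable borel" "g \<in> borel_measurable borel"
      "\<mu> \<in> borel_measurable borel"
    and det: "\<And>y. det (\<mu> y) \<noteq> 0"
    and f: "integrable lborel (\<lambda>x. norm (f x))"
    and g: "integrable lborel (\<lambda>x. norm (g x) powr enn2real p)"
  shows "AE x in lborel. integrable lborel (adaptive_integrand p \<mu> f g x)"
    and "(\<integral>\<^sup>+x. norm (LINT y|lborel. adaptive_integrand p \<mu> f g x y) powr enn2real p \<partial>lborel)
      \<le> ennreal ((LINT x|lborel. norm (f x)) powr enn2real p *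
          (LINT x|lborel. norm (g x) powr enn2real p))"
proof -
  define q where "q = enn2real p"
  have q: "1 \<le> q"
    using p enn2real_mono[of 1 p] by (simp add: q_def top.not_eq_extremum)
  define F where "F = (LINT x|lborel. norm (f x))"
  define G where "G = (LINT x|lborel. norm (g x) powr q)"
  have F0: "0 \<le> F" and G0: "0 \<le> G"
    by (simp_all add: F_def G_def)
  \<comment> \<open>The part of the integrand averaged against the weight \<open>norm (f y)\<close>; its \<open>q\<close>-th power carries
      exactly the Jacobian of the substitution \<open>z = \<mu> y *v (x - y)\<close>.\<close>
  define h where "h x y = \<bar>det (\<mu> y)\<bar> powr (1/q) * norm (g (\<mu> y *v (x - y)))" for x y
  have [measurable]: "h x \<in> borel_measurable borel" for x
    unfolding h_def by measurable
  have h0: "0 \<le> h x y" for x y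
    by (simp add: h_def)
  have norm_eq: "norm (adaptive_integrand p \<mu> f g x y) = norm (f y) * h x y" for x y
    using p by (simp add: adaptive_integrand_def recip_exponent_def h_def q_def norm_mult)
  have hq: "h x y powr q = \<bar>det (\<mu> y)\<bar> * norm (g (\<mu> y *v (x - y))) powr q" for x y
    using q by (simp add: h_def powr_mult powr_powr)
  define A where "A x = (\<integral>\<^sup>+y. norm (f y) * h x y powr q \<partial>lborel)" for x
  have [measurable]: "A \<in> borel_measurable borel"
    unfolding A_def hq by measurable
  have "(\<integral>\<^sup>+x. A x \<partial>lborel) = (\<integral>\<^sup>+y. norm (f y) \<partial>lborel) * (\<integral>\<^sup>+x. norm (g x) powr q \<partial>lborel)"
    unfolding A_def hq
    by (subst nn_integral_adaptive[where \<mu> = \<mu>, OF _ _ _ det, symmetric]) (simp_all add: ennreal_mult)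
  also have "\<dots> = ennreal F * ennreal G"
    using f g by (simp add: F_def G_def q_def nn_integral_eq_integral)
  finally have A: "(\<integral>\<^sup>+x. A x \<partial>lborel) = ennreal F * ennreal G" .
  then have "AE x in lborel. A x \<noteq> \<infinity>"
    by (intro nn_integral_PInf_AE) (simp_all add: ennreal_mult_eq_top_iff)
  then have *: "AE x in lborel. integrable lborel (adaptive_integrand p \<mu> f g x) \<and>
      ennreal (norm (LINT y|lborel. adaptive_integrand p \<mu> f g x y) powr q)
        \<le> ennreal (F powr (q - 1)) * A x"
  proof eventually_elim
    case (elim x)
    have [measurable]: "adaptive_integrand p \<mu> f g x \<in> borel_measurable borel"
      unfolding adaptive_integrand_def by measurable
    have wh: "integrable lborel (\<lambda>y. norm (f y) * h x y powr q)"
      using elim by (intro integrableI_nonneg) (simp_all add: A_def top.not_eq_extremum)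
    note mean = weighted_powr_mean[OF q f norm_ge_zero _ h0 wh]
    have "integrable lborel (\<lambda>y. norm (adaptive_integrand p \<mu> f g x y))"
      unfolding norm_eq by (rule mean) simp
    then have int: "integrable lborel (adaptive_integrand p \<mu> f g x)"
      by (simp add: integrable_norm_iff)
    have "norm (LINT y|lborel. adaptive_integrand p \<mu> f g x y) \<le> (LINT y|lborel. norm (f y) * h x y)"
      using integral_norm_bound[of lborel "adaptive_integrand p \<mu> f g x"] unfolding norm_eq .
    then have "norm (LINT y|lborel. adaptive_integrand p \<mu> f g x y) powr q
        \<le> (LINT y|lborel. norm (f y) * h x y) powr q"
      using q by (intro powr_mono2) auto
    also have "\<dots> \<le> F powr (q - 1) * (LINT y|lborel. norm (f y) * h x y powr q)"
      unfolding F_def by (rule mean) simp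
    finally have "ennreal (norm (LINT y|lborel. adaptive_integrand p \<mu> f g x y) powr q)
        \<le> ennreal (F powr (q - 1)) * ennreal (LINT y|lborel. norm (f y) * h x y powr q)"
      by (subst ennreal_mult[symmetric]) (auto intro: ennreal_leI)
    also have "ennreal (LINT y|lborel. norm (f y) * h x y powr q) = A x"
      unfolding A_def using wh by (intro nn_integral_eq_integral[symmetric]) auto
    finally show ?case
      using int by simp
  qed
  then show "AE x in lborel. integrable lborel (adaptive_integrand p \<mu> f g x)"
    by eventually_elim simp
  have "(\<integral>\<^sup>+x. norm (LINT y|lborel. adaptive_integrand p \<mu> f g x y) powr q \<partial>lborel)
      \<le> (\<integral>\<^sup>+x. ennreal (F powr (q - 1)) * A x \<partial>lborel)"
    using * by (intro nn_integral_mono_AE) (auto elim: eventually_mono)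
  also have "\<dots> = ennreal (F powr (q - 1)) * (ennreal F * ennreal G)"
    by (simp add: nn_integral_cmult A)
  also have "\<dots> = ennreal (F powr q * G)"
    using F0 G0 by (cases "F = 0") (simp_all add: ennreal_mult[symmetric] powr_diff)
  finally show "(\<integral>\<^sup>+x. norm (LINT y|lborel. adaptive_integrand p \<mu> f g x y) powr enn2real p \<partial>lborel)
      \<le> ennreal ((LINT x|lborel. norm (f x)) powr enn2real p *
          (LINT x|lborel. norm (g x) powr enn2real p))"
    by (simp add: F_def G_def q_def)
qed

lemma adaptive_convolution_borel_infinite:
  fixes f g :: "real^'n \<Rightarrow> 'b::{real_normed_field, banach, second_countable_topology}"
  assumes meas [measurable]: "f \<in> borel_measurable borel" "g \<in> borel_measurable borel"
      "\<mu> \<in> borel_measurable borel"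
    and det: "\<And>y. det (\<mu> y) \<noteq> 0"
    and f: "integrable lborel (\<lambda>x. norm (f x))"
    and g: "AE z in lborel. norm (g z) \<le> S"
  shows "AE x in lborel. integrable lborel (adaptive_integrand \<infinity> \<mu> f g x)"
    and "AE x in lborel. norm (LINT y|lborel. adaptive_integrand \<infinity> \<mu> f g x y)
      \<le> (LINT x|lborel. norm (f x)) * S"
proof -
  have "AE x in lborel. integrable lborel (adaptive_integrand \<infinity> \<mu> f g x) \<and>
     norm (LINT y|lborel. adaptive_integrand \<infinity> \<mu> f g x y) \<le> (LINT x|lborel. norm (f x)) * S"
    using AE_adaptive[OF meas(3) det g]
  proof eventually_elim
    case (elim x)
    have [measurable]: "adaptive_integrand \<infinity> \<mu> f g x \<in> borel_measurable borel"
      unfolding adaptive_integrand_def by measurable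
    have bound: "AE y in lborel. norm (adaptive_integrand \<infinity> \<mu> f g x y) \<le> norm (f y) * S"
      using elim det by (auto elim!: eventually_mono simp: adaptive_integrand_def
          recip_exponent_def norm_mult intro: mult_left_mono)
    have fS: "integrable lborel (\<lambda>y. norm (f y) * S)"
      using f by simp
    have int: "integrable lborel (adaptive_integrand \<infinity> \<mu> f g x)"
      using bound by (intro Bochner_Integration.integrable_bound[OF fS]) (auto elim!: eventually_mono)
    have "norm (LINT y|lborel. adaptive_integrand \<infinity> \<mu> f g x y)
        \<le> (LINT y|lborel. norm (adaptive_integrand \<infinity> \<mu> f g x y))"
      by (rule integral_norm_bound)
    also have "\<dots> \<le> (LINT y|lborel. norm (f y) * S)"
      using int fS bound by (intro integral_mono_AE) auto
    finally show ?case
      using int by simp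
  qed
  then show "AE x in lborel. integrable lborel (adaptive_integrand \<infinity> \<mu> f g x)"
    and "AE x in lborel. norm (LINT y|lborel. adaptive_integrand \<infinity> \<mu> f g x y)
      \<le> (LINT x|lborel. norm (f x)) * S"
    by (auto elim: eventually_mono)
qed

lemma adaptive_convolution_borel:
  fixes f g :: "real^'n \<Rightarrow> 'b::{real_normed_field, banach, second_countable_topology}"
  assumes p: "1 \<le> p"
    and meas [measurable]: "f \<in> borel_measurable borel" "g \<in> borel_measurable borel"
      "\<mu> \<in> borel_measurable borel"
    and det: "\<And>y. det (\<mu> y) \<noteq> 0"
    and f: "f \<in> Lp_space 1 lebesgue" and g: "g \<in> Lp_space p lebesgue"
  defines "k \<equiv> \<lambda>x. LINT y|lborel. adaptive_integrand p \<mu> f g x y"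
  shows "AE x in lborel. integrable lborel (adaptive_integrand p \<mu> f g x)"
    and "k \<in> borel_measurable borel"
    and "k \<in> Lp_space p lebesgue"
    and "Lp_norm p lebesgue k \<le> Lp_norm 1 lebesgue f * Lp_norm p lebesgue g"
proof -
  have "(\<lambda>x. LINT y|lborel. (case (x, y) of (x, y) \<Rightarrow> adaptive_integrand p \<mu> f g x y))
      \<in> borel_measurable lborel"
    by (rule lborel.borel_measurable_lebesgue_integral) measurable
  then show k[measurable]: "k \<in> borel_measurable borel"
    by (simp add: k_def)
  have k_leb: "k \<in> borel_measurable lebesgue"
    by (simp add: measurable_completion)
  have fi: "integrable lborel (\<lambda>x. norm (f x))"
    using f by (simp add: Lp_space_def integrable_completion)
  have f_norm: "Lp_norm 1 lebesgue f = (LINT x|lborel. norm (f x))"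
    by (simp add: Lp_norm_def integral_completion)
  define F where "F = (LINT x|lborel. norm (f x))"
  have F0: "0 \<le> F" by (simp add: F_def)
  have "(AE x in lborel. integrable lborel (adaptive_integrand p \<mu> f g x)) \<and>
    k \<in> Lp_space p lebesgue \<and> Lp_norm p lebesgue k \<le> F * Lp_norm p lebesgue g"
  proof (cases "p = \<infinity>")
    case True
    define S where "S = Lp_norm \<infinity> lebesgue g"
    have S: "esssup lebesgue (\<lambda>x. ennreal (norm (g x))) = ennreal S"
      using g True by (simp add: S_def Lp_norm_def Lp_space_def top.not_eq_extremum)
    have S0: "0 \<le> S" by (simp add: S_def Lp_norm_def)
    have "AE z in lborel. norm (g z) \<le> S"
      using esssup_AE[of "\<lambda>x. ennreal (norm (g x))" lebesgue] S0
      unfolding S AE_completion_iff by simp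
    note young = adaptive_convolution_borel_infinite[OF meas det fi this]
    have "esssup lebesgue (\<lambda>x. ennreal (norm (k x))) \<le> ennreal (F * S)"
    proof (rule esssup_I)
      show "AE x in lebesgue. ennreal (norm (k x)) \<le> ennreal (F * S)"
        using young(2) True by (auto simp: AE_completion_iff k_def F_def elim!: eventually_mono
            intro: ennreal_leI)
    qed (use k_leb in measurable)
    then have "k \<in> Lp_space \<infinity> lebesgue" and "Lp_norm \<infinity> lebesgue k \<le> F * S"
      using k_leb F0 S0 enn2real_mono[of "esssup lebesgue (\<lambda>x. ennreal (norm (k x)))" "ennreal (F * S)"]
      by (auto simp: Lp_space_def Lp_norm_def top.not_eq_extremum[symmetric] top_unique)
    with young(1) True show ?thesis
      by (simp add: S_def)
  next
    case False
    define q where "q = enn2real p"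
    have q: "1 \<le> q"
      using p False enn2real_mono[of 1 p] by (simp add: q_def top.not_eq_extremum)
    define G where "G = (LINT x|lborel. norm (g x) powr q)"
    have G0: "0 \<le> G" by (simp add: G_def)
    have gi: "integrable lborel (\<lambda>x. norm (g x) powr q)"
      using g False by (simp add: Lp_space_def integrable_completion q_def)
    have g_norm: "Lp_norm p lebesgue g = G powr (1 / q)"
      using False by (simp add: Lp_norm_def integral_completion G_def q_def)
    note young = adaptive_convolution_borel_finite[OF p False meas det fi gi[unfolded q_def]]
    have le: "(\<integral>\<^sup>+x. norm (k x) powr q \<partial>lborel) \<le> ennreal (F powr q * G)"
      using young(2) by (simp add: k_def F_def G_def q_def)
    then have ki: "integrable lborel (\<lambda>x. norm (k x) powr q)"
      by (intro integrableI_nonneg) (auto simp: top.not_eq_extremum[symmetric] top_unique)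
    have "ennreal (LINT x|lborel. norm (k x) powr q) \<le> ennreal (F powr q * G)"
      using le by (simp add: nn_integral_eq_integral[OF ki])
    then have "(LINT x|lborel. norm (k x) powr q) \<le> F powr q * G"
      using G0 by (simp add: ennreal_le_iff)
    then have "(LINT x|lborel. norm (k x) powr q) powr (1 / q) \<le> (F powr q * G) powr (1 / q)"
      using q by (intro powr_mono2) auto
    also have "\<dots> = F * G powr (1 / q)"
      using q F0 by (simp add: powr_mult powr_powr)
    finally have "Lp_norm p lebesgue k \<le> F * Lp_norm p lebesgue g"
      unfolding g_norm using False by (simp add: Lp_norm_def integral_completion flip: q_def)
    moreover have "k \<in> Lp_space p lebesgue"
      using False ki k_leb by (simp add: Lp_space_def integrable_completion q_def)
    ultimately show ?thesis
      using young(1) by simp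
  qed
  then show "AE x in lborel. integrable lborel (adaptive_integrand p \<mu> f g x)"
    and "k \<in> Lp_space p lebesgue"
    and "Lp_norm p lebesgue k \<le> Lp_norm 1 lebesgue f * Lp_norm p lebesgue g"
    by (simp_all add: f_norm F_def)
qed

section \<open>Lebesgue measurable functions\<close>

theorem corollary6:
  fixes p :: ennreal
    and f g :: "real^'n \<Rightarrow> 'b::{real_normed_field, banach, second_countable_topology}"
    and \<mu> :: "real^'n \<Rightarrow> real^'n^'n"
  assumes "1 \<le> p"
    and "f \<in> Lp_space 1 lebesgue"
    and "g \<in> Lp_space p lebesgue"
    and "\<mu> \<in> borel_measurable lebesgue"
    and "\<And>y. invertible (\<mu> y)"
  shows "(AE x in lebesgue. integrable lebesgue (adaptive_integrand p \<mu> f g x)) \<and>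
    adaptive_convolution p \<mu> f g \<in> Lp_space p lebesgue \<and>
    Lp_norm p lebesgue (adaptive_convolution p \<mu> f g) \<le> Lp_norm 1 lebesgue f * Lp_norm p lebesgue g"
proof -
  have f: "f \<in> borel_measurable lebesgue" and g: "g \<in> borel_measurable lebesgue"
    using assms(2,3) by (simp_all add: Lp_space_def)
  obtain Nf where Nf: "Nf \<in> null_sets lborel"
    and f0: "(\<lambda>x. if x \<in> Nf then 0 else f x) \<in> borel_measurable lborel"
    using completion_ex_borel_modification[OF f] .
  obtain Ng where Ng: "Ng \<in> null_sets lborel"
    and g0: "(\<lambda>x. if x \<in> Ng then 0 else g x) \<in> borel_measurable lborel"
    using completion_ex_borel_modification[OF g] .
  obtain N\<mu> where N\<mu>: "N\<mu> \<in> null_sets lborel"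
    and \<mu>0: "(\<lambda>x. if x \<in> N\<mu> then mat 1 else \<mu> x) \<in> borel_measurable lborel"
    using completion_ex_borel_modification[OF assms(4)] .
  define f' where "f' x = (if x \<in> Nf then 0 else f x)" for x
  define g' where "g' x = (if x \<in> Ng then 0 else g x)" for x
  define \<mu>' where "\<mu>' x = (if x \<in> N\<mu> then mat 1 else \<mu> x)" for x
  have meas [measurable]: "f' \<in> borel_measurable borel" "g' \<in> borel_measurable borel"
      "\<mu>' \<in> borel_measurable borel"
    using f0 g0 \<mu>0 by (simp_all add: f'_def[abs_def] g'_def[abs_def] \<mu>'_def[abs_def])
  have det: "det (\<mu>' y) \<noteq> 0" for y
    using assms(5) by (simp add: \<mu>'_def invertible_det_nz)
  have eq: "AE x in lborel. f x = f' x" "AE x in lborel. g x = g' x" "AE x in lborel. \<mu> x = \<mu>' x"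
    by (rule eventually_mono[OF AE_not_in[OF Nf]], simp add: f'_def)
      (rule eventually_mono[OF AE_not_in[OF Ng]], simp add: g'_def,
       rule eventually_mono[OF AE_not_in[OF N\<mu>]], simp add: \<mu>'_def)
  have leb: "f' \<in> borel_measurable lebesgue" "g' \<in> borel_measurable lebesgue"
    by (simp_all add: measurable_completion)
  note f_cong = Lp_AE_cong[OF f leb(1) AE_completion[OF eq(1)]]
  note g_cong = Lp_AE_cong[OF g leb(2) AE_completion[OF eq(2)]]
  define k where "k x = (LINT y|lborel. adaptive_integrand p \<mu>' f' g' x y)" for x
  note borel = adaptive_convolution_borel[OF assms(1) meas det assms(2)[unfolded f_cong]
      assms(3)[unfolded g_cong], folded k_def]
  have *: "AE x in lborel. integrable lebesgue (adaptive_integrand p \<mu> f g x) \<and>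
      adaptive_convolution p \<mu> f g x = k x"
    using borel(1) AE_adaptive[OF meas(3) det eq(2)]
  proof eventually_elim
    case (elim x)
    \<comment> \<open>Off the null sets, neither \<open>f y\<close>, \<open>\<mu> y\<close> nor the value of \<open>g\<close> at \<open>\<mu>' y *v (x - y)\<close> was changed.\<close>
    have ae: "AE y in lborel. adaptive_integrand p \<mu> f g x y = adaptive_integrand p \<mu>' f' g' x y"
      using elim(2) eq(1,3) by eventually_elim (simp add: adaptive_integrand_def)
    have m': "adaptive_integrand p \<mu>' f' g' x \<in> borel_measurable lborel"
      unfolding adaptive_integrand_def by measurable
    note m = completion_AE_eq_measurable[OF m' ae]
    have "integrable lebesgue (adaptive_integrand p \<mu> f g x)
        \<longleftrightarrow> integrable lebesgue (adaptive_integrand p \<mu>' f' g' x)"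
      using m measurable_completion[OF m'] AE_completion[OF ae] by (rule integrable_cong_AE)
    moreover have "adaptive_convolution p \<mu> f g x
        = (LINT y|lebesgue. adaptive_integrand p \<mu>' f' g' x y)"
      unfolding adaptive_convolution_def
      using m measurable_completion[OF m'] AE_completion[OF ae] by (rule integral_cong_AE)
    ultimately show ?case
      using elim(1) m' by (simp add: integrable_completion integral_completion k_def)
  qed
  then have conv: "AE x in lborel. adaptive_convolution p \<mu> f g x = k x"
    by eventually_elim simp
  have k: "k \<in> borel_measurable lborel" using borel(2) by simp
  note k_cong = Lp_AE_cong[OF completion_AE_eq_measurable[OF k conv] measurable_completion[OF k]
      AE_completion[OF conv]]
  have "AE x in lebesgue. integrable lebesgue (adaptive_integrand p \<mu> f g x)"
    using AE_completion[OF *] by eventually_elim simp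
  with borel(3,4) show ?thesis
    by (simp add: k_cong f_cong g_cong)
qed

end
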